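(* Let $d,r\ge1$ be integers, let $\alpha>1$, let $F_k^j$ ($1\le k\le d$, $1\le j\le r$) be distribution functions of nonnegative random variables with $\overline{F_k^j}\in\mathcal{RV}_{-\alpha}$, and let $F$ be a distribution function with $\overline{F_k^j}(x)\sim a_k^j\overline F(x)$ as $x\to\infty$ for constants $a_k^j>0$. Consider the $d$-dimensional renewal model described in the context with these claim-size distributions, and suppose that all claim arrival processes $\{N_{k,t}^j\}_{t\ge0}$ are homogeneous Poisson processes with intensities $\lambda_k^j$, so that $\lambda_{k,t}^j:=\mathbb{E}[N_{k,t}^j]=\lambda_k^jt$ for $t\ge0$. Suppose further that the investment return process is $$R_t=\mu t+\sigma W_t+\sum_{i=1}^{N_t'}\zeta_i,$$ where $\mu,\sigma\ge0$, $\{W_t\}_{t\ge0}$ is a standard Brownian motion, $\zeta_1,\zeta_2,\dots$ are i.i.d. standard normal, $\{N_t'\}_{t\ge0}$ is a homogeneous Poisson process with intensity $\lambda$, all these components being mutually independent and independent of the rest of the model; and that $\mathbb{E}[R_1]>0$ and $\phi_R(\alpha^* )<0$ for some $\alpha^*>\alpha$, where $\phi_R(a)=\log\mathbb{E}[e^{-aR_1}]$. Let $p^A(x,t)$, $\mathrm{SES}^A(q,k,t)$, $\mathrm{MES}^A(q,k,t)$ ($1\le k\le d$, $0<q<1$, $t\in\Lambda$) be the asymptotic approximations defined in the context. Then: (i) $p^A(x,t)$, $\mathrm{SES}^A(q,k,t)$ and $\mathrm{MES}^A(q,k,t)$ are decreasing with $\mu$, given that the other parameters are fixed; (ii) $p^A(x,t)$,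 $\mathrm{SES}^A(q,k,t)$ and $\mathrm{MES}^A(q,k,t)$ are increasing with $\sigma$, and increasing with $\lambda$, in each case given that the other parameters are fixed.
   Context: Model. For $1\le k\le d$ (business line) and $1\le j\le r$ (claim type), the nonnegative claim sizes $\{X_{ki}^j;i\ge1\}$ have common distribution $F_k^j$, and all claim sizes (over all $i,k,j$) are pairwise asymptotically independent: nonnegative unbounded random variables $Y_1,Y_2$ with distributions $G_1,G_2$ are asymptotically independent if $\mathbb{P}(Y_1>U_1(x),Y_2>U_2(x))/\mathbb{P}(Y_1>U_1(x))\to0$ as $x\to\infty$, where $U_i=(1/\overline{G_i})^{\gets}$ is the generalized inverse. Claims of type $j$ in line $k$ have inter-arrival times $\theta_{ki}^j$, arrival times $\tau_{ki}^j=\sum_{h=1}^i\theta_{kh}^j$ and counting process $N_{k,t}^j=\sup\{m\ge0:\tau_{km}^j\le t\}$ (with $\tau_{k0}^j=0$). For each $k$, the vectors $(\theta_{ki}^1,\dots,\theta_{ki}^r)$, $i\ge1$, are i.i.d., with arbitrary dependence among the components of each vector. The claim sizes, the arrival processes, and the process $\{R_t\}$ are otherwise mutually independent. With premium rates $c_k>0$, the discounted net loss of line $k$ is $Z_{k,t}=\sum_{j=1}^r\sum_{i=1}^{N_{k,t}^j}X_{ki}^je^{-R_{\tau_{ki}^j}}-c_k\int_0^te^{-R_s}\,\mathrm{d}s$, with total $D_t=\sum_{k=1}^dZ_{k,t}$. The time set is $\Lambda=\{t\ge0:0<\lambda_{k,t}^j\le\infty\text{ for all }k,j\}$ (including $t=\infty$),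 which is $(0,\infty]$ for Poisson arrivals. The asymptotic approximations of $\mathbb{P}(D_t>x)$ (as $x\to\infty$), and of $\mathrm{SES}_{q,k}(D_t)=\mathbb{E}[(Z_{k,t}-\mathrm{VaR}_q(Z_{k,t}))^+\mid D_t>\mathrm{VaR}_q(D_t)]$ and $\mathrm{MES}_{q,k}(D_t)=\mathbb{E}[Z_{k,t}\mid D_t>\mathrm{VaR}_q(D_t)]$ (as $q\uparrow1$), are the following explicit quantities: $$p^A(x,t)=\sum_{k=1}^d\sum_{j=1}^r\overline{F_k^j}(x)\int_{0-}^te^{s\phi_R(\alpha)}\,\mathrm{d}\lambda_{k,s}^j,$$ $$\mathrm{SES}^A(q,k,t)=\frac{l_k(t)}{\sum_{i=1}^dl_i(t)}\left(\Big(\sum_{i=1}^dl_i(t)\Big)^{\frac1\alpha}-(l_k(t))^{\frac1\alpha}+\frac{(\sum_{i=1}^dl_i(t))^{\frac1\alpha}}{\alpha-1}\right)F^{\gets}(q),$$ $$\mathrm{MES}^A(q,k,t)=\frac{\alpha}{\alpha-1}\,\frac{l_k(t)}{(\sum_{i=1}^dl_i(t))^{1-\frac1\alpha}}\,F^{\gets}(q),$$ where $l_k(t)=\sum_{j=1}^ra_k^j\int_{0-}^te^{s\phi_R(\alpha)}\,\mathrm{d}\lambda_{k,s}^j$ and, here, $\mathrm{d}\lambda_{k,s}^j=\lambda_k^j\,\mathrm{d}s$. Notation. $\overline F=1-F$; $F^{\gets}(q)=\inf\{y\in\mathbb{R}:F(y)\ge q\}$; $\mathrm{VaR}_q(X)=F_X^{\gets}(q)$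 with $F_X$ the distribution function of $X$; $\overline F\in\mathcal{RV}_{-\alpha}$ means $\lim_{x\to\infty}\overline F(yx)/\overline F(x)=y^{-\alpha}$ for all $y>0$.
   Formalization: The SES^A and MES^A claims are stated only for q with F^←(q) ≥ 0 (strict monotonicity when F^←(q) > 0), since for a distribution function F with F^←(q) < 0 both quantities are negative and their monotonicity is reversed. *)

theory Defs
  imports "HOL-Probability.Probability"
begin

section \<open>Distribution functions and tails\<close>

definition distribution_function :: "(real \<Rightarrow> real) \<Rightarrow> bool" where
  "distribution_function G \<longleftrightarrow> (\<exists>P. real_distribution P \<and> G = cdf P)"

definition generalized_inverse :: "(real \<Rightarrow> real) \<Rightarrow> real \<Rightarrow> real" where
  "generalized_inverse h u = Inf {y. h y \<ge> u}"

definition regularly_varying_tail :: "(real \<Rightarrow> real) \<Rightarrow> real \<Rightarrow> bool" where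
  "regularly_varying_tail G \<alpha> \<longleftrightarrow>
     (\<forall>y>0. ((\<lambda>x. (1 - G (y * x)) / (1 - G x)) \<longlongrightarrow> y powr - \<alpha>) at_top)"

text \<open>For unbounded \<open>Y\<close> the function \<open>1 / (1 - G)\<close> below involves no division by zero. At bounded
  levels \<open>u\<close> the set in \<^const>\<open>generalized_inverse\<close> may be all of the line; only the
  behaviour for large \<open>u\<close> is used.\<close>

definition tail_quantile :: "'a measure \<Rightarrow> ('a \<Rightarrow> real) \<Rightarrow> real \<Rightarrow> real" where
  "tail_quantile M Y = generalized_inverse (\<lambda>y. 1 / (1 - cdf (distr M borel Y) y))"

definition asymptotically_independent ::
  "'a measure \<Rightarrow> ('a \<Rightarrow> real) \<Rightarrow> ('a \<Rightarrow> real) \<Rightarrow> bool" where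
  "asymptotically_independent M Y1 Y2 \<longleftrightarrow>
     ((\<lambda>x. measure M {\<omega> \<in> space M. Y1 \<omega> > tail_quantile M Y1 x \<and> Y2 \<omega> > tail_quantile M Y2 x}
          / measure M {\<omega> \<in> space M. Y1 \<omega> > tail_quantile M Y1 x}) \<longlongrightarrow> 0) at_top"

section \<open>Poisson processes and Brownian motion\<close>

definition independent_increments ::
  "'a measure \<Rightarrow> 'b measure \<Rightarrow> (real \<Rightarrow> 'a \<Rightarrow> 'b :: minus) \<Rightarrow> bool" where
  "independent_increments M S Y \<longleftrightarrow>
     (\<forall>n ts. 0 \<le> ts (0 :: nat) \<and> mono ts \<longrightarrow>
        prob_space.indep_vars M (\<lambda>_. S) (\<lambda>i \<omega>. Y (ts (Suc i)) \<omega> - Y (ts i) \<omega>) {..<n})"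

text \<open>Counting processes are extended-natural-valued, because a renewal process may explode on a
  null set. Right-continuity of the paths is stated as being locally constant to the right.\<close>

definition homogeneous_poisson_process ::
  "'a measure \<Rightarrow> real \<Rightarrow> (real \<Rightarrow> 'a \<Rightarrow> enat) \<Rightarrow> bool" where
  "homogeneous_poisson_process M rate N \<longleftrightarrow>
     0 \<le> rate \<and>
     (\<forall>t\<ge>0. N t \<in> M \<rightarrow>\<^sub>M count_space UNIV) \<and>
     (AE \<omega> in M. N 0 \<omega> = 0) \<and>
     independent_increments M (count_space UNIV) N \<and>
     (\<forall>s t m. 0 \<le> s \<and> s \<le> t \<longrightarrow>
        measure M {\<omega> \<in> space M. N t \<omega> - N s \<omega> = enat m}
          = (rate * (t - s)) ^ m / fact m * exp (- (rate * (t - s)))) \<and>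
     (AE \<omega> in M. mono_on {0..} (\<lambda>t. N t \<omega>)) \<and>
     (AE \<omega> in M. \<forall>t\<ge>0. \<forall>\<^sub>F s in at_right t. N s \<omega> = N t \<omega>)"

definition standard_brownian_motion :: "'a measure \<Rightarrow> (real \<Rightarrow> 'a \<Rightarrow> real) \<Rightarrow> bool" where
  "standard_brownian_motion M W \<longleftrightarrow>
     (\<forall>t\<ge>0. W t \<in> borel_measurable M) \<and>
     (AE \<omega> in M. W 0 \<omega> = 0) \<and>
     independent_increments M borel W \<and>
     (\<forall>s t. 0 \<le> s \<and> s < t \<longrightarrow>
        distributed M lborel (\<lambda>\<omega>. W t \<omega> - W s \<omega>) (normal_density 0 (sqrt (t - s)))) \<and>
     (AE \<omega> in M. continuous_on {0..} (\<lambda>t. W t \<omega>))"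

section \<open>Renewal arrivals\<close>

definition arrival_time :: "(nat \<Rightarrow> 'a \<Rightarrow> real) \<Rightarrow> nat \<Rightarrow> 'a \<Rightarrow> real" where
  "arrival_time \<theta> n \<omega> = (\<Sum>h = 1..n. \<theta> h \<omega>)"

definition arrival_count :: "(nat \<Rightarrow> 'a \<Rightarrow> real) \<Rightarrow> ereal \<Rightarrow> 'a \<Rightarrow> enat" where
  "arrival_count \<theta> t \<omega> = Sup {enat m | m. ereal (arrival_time \<theta> m \<omega>) \<le> t}"

definition renewal_function :: "'a measure \<Rightarrow> (nat \<Rightarrow> 'a \<Rightarrow> real) \<Rightarrow> ereal \<Rightarrow> ennreal" where
  "renewal_function M \<theta> t = (\<integral>\<^sup>+ \<omega>. ennreal_of_enat (arrival_count \<theta> t \<omega>) \<partial>M)"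

text \<open>The Stieltjes measure of the renewal function. For nonnegative inter-arrival times the renewal
  function vanishes on the negative half-line, so a jump at \<open>0\<close> is an atom of this measure, in
  accordance with the lower limit \<open>0-\<close> of the integrals.\<close>

definition renewal_measure :: "'a measure \<Rightarrow> (nat \<Rightarrow> 'a \<Rightarrow> real) \<Rightarrow> real measure" where
  "renewal_measure M \<theta> = interval_measure (\<lambda>s. enn2real (renewal_function M \<theta> (ereal s)))"

definition time_set ::
  "'a measure \<Rightarrow> nat \<Rightarrow> nat \<Rightarrow> (nat \<Rightarrow> nat \<Rightarrow> nat \<Rightarrow> 'a \<Rightarrow> real) \<Rightarrow> ereal set" where
  "time_set M d r \<theta> = {t. 0 \<le> t \<and> (\<forall>k\<in>{1..d}. \<forall>j\<in>{1..r}. 0 < renewal_function M (\<theta> k j) t)}"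

section \<open>The renewal risk model\<close>

text \<open>The events generated by the random variables \<open>Y i\<close>, \<open>i \<in> I\<close>.\<close>

definition generated_events ::
  "'a measure \<Rightarrow> 'b measure \<Rightarrow> ('i \<Rightarrow> 'a \<Rightarrow> 'b) \<Rightarrow> 'i set \<Rightarrow> 'a set set" where
  "generated_events M S Y I = sigma_sets (space M) (\<Union>i\<in>I. {Y i -` A \<inter> space M | A. A \<in> sets S})"

text \<open>Lines \<open>k\<close>, claim types \<open>j\<close> and claim numbers \<open>i\<close> are counted from \<open>1\<close>; \<open>X k j i\<close> and
  \<open>\<theta> k j i\<close> are the \<open>i\<close>-th claim size and inter-arrival time. Claim sizes, arrivals and
  investment returns are independent as three groups; nothing is assumed within the group of claim
  sizes beyond pairwise asymptotic independence, nor between the arrivals of different lines.\<close>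

locale renewal_risk_model = prob_space M for M :: "'a measure" +
  fixes d r :: nat
    and claim_cdf :: "nat \<Rightarrow> nat \<Rightarrow> real \<Rightarrow> real"
    and c :: "nat \<Rightarrow> real"
    and X \<theta> :: "nat \<Rightarrow> nat \<Rightarrow> nat \<Rightarrow> 'a \<Rightarrow> real"
    and R :: "real \<Rightarrow> 'a \<Rightarrow> real"
  assumes lines_types: "d \<ge> 1" "r \<ge> 1"
    and premium: "k \<in> {1..d} \<Longrightarrow> c k > 0"
    and claim_rv: "\<lbrakk>k \<in> {1..d}; j \<in> {1..r}; i \<ge> 1\<rbrakk> \<Longrightarrow> X k j i \<in> borel_measurable M"
    and claim_nonneg: "\<lbrakk>k \<in> {1..d}; j \<in> {1..r}; i \<ge> 1\<rbrakk> \<Longrightarrow> AE \<omega> in M. X k j i \<omega> \<ge> 0"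
    and claim_distr: "\<lbrakk>k \<in> {1..d}; j \<in> {1..r}; i \<ge> 1\<rbrakk> \<Longrightarrow>
      cdf (distr M borel (X k j i)) = claim_cdf k j"
    and claims_asymp_indep:
      "\<lbrakk>k \<in> {1..d}; j \<in> {1..r}; i \<ge> 1; k' \<in> {1..d}; j' \<in> {1..r}; i' \<ge> 1; (k, j, i) \<noteq> (k', j', i')\<rbrakk>
        \<Longrightarrow> asymptotically_independent M (X k j i) (X k' j' i')"
    and interarrival_nonneg:
      "\<lbrakk>k \<in> {1..d}; j \<in> {1..r}; i \<ge> 1\<rbrakk> \<Longrightarrow> AE \<omega> in M. \<theta> k j i \<omega> \<ge> 0"
    and interarrival_indep: "k \<in> {1..d} \<Longrightarrow>
      indep_vars (\<lambda>_. \<Pi>\<^sub>M j\<in>{1..r}. borel) (\<lambda>i \<omega>. \<lambda>j\<in>{1..r}. \<theta> k j i \<omega>) {1..}"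
    and interarrival_ident: "\<lbrakk>k \<in> {1..d}; i \<ge> 1\<rbrakk> \<Longrightarrow>
      distr M (\<Pi>\<^sub>M j\<in>{1..r}. borel) (\<lambda>\<omega>. \<lambda>j\<in>{1..r}. \<theta> k j i \<omega>)
        = distr M (\<Pi>\<^sub>M j\<in>{1..r}. borel) (\<lambda>\<omega>. \<lambda>j\<in>{1..r}. \<theta> k j 1 \<omega>)"
    and return_rv: "t \<ge> 0 \<Longrightarrow> R t \<in> borel_measurable M"
    and groups_indep:
      "indep_sets (\<lambda>g. [generated_events M borel (\<lambda>(k, j, i). X k j i) ({1..d} \<times> {1..r} \<times> {1..}),
                         generated_events M borel (\<lambda>(k, j, i). \<theta> k j i) ({1..d} \<times> {1..r} \<times> {1..}),
                         generated_events M borel R {0..}] ! g) {..<3}"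

text \<open>The discounted net losses, to which the approximations below refer.\<close>

definition (in renewal_risk_model) net_loss :: "nat \<Rightarrow> ereal \<Rightarrow> 'a \<Rightarrow> real" where
  "net_loss k t \<omega> =
     (\<Sum>j = 1..r. \<Sum>\<^sub>\<infinity>i | 1 \<le> i \<and> enat i \<le> arrival_count (\<theta> k j) t \<omega>.
        X k j i \<omega> * exp (- R (arrival_time (\<theta> k j) i \<omega>) \<omega>))
     - c k * (LINT s:{s. 0 \<le> s \<and> ereal s \<le> t}|lborel. exp (- R s \<omega>))"

definition (in renewal_risk_model) total_net_loss :: "ereal \<Rightarrow> 'a \<Rightarrow> real" where
  "total_net_loss t \<omega> = (\<Sum>k = 1..d. net_loss k t \<omega>)"

section \<open>The asymptotic approximations\<close>

definition laplace_exponent :: "'a measure \<Rightarrow> (real \<Rightarrow> 'a \<Rightarrow> real) \<Rightarrow> real \<Rightarrow> real" where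
  "laplace_exponent M R a = ln (\<integral>\<omega>. exp (- a * R 1 \<omega>) \<partial>M)"

definition discounted_renewal ::
  "'a measure \<Rightarrow> real \<Rightarrow> (nat \<Rightarrow> 'a \<Rightarrow> real) \<Rightarrow> (real \<Rightarrow> 'a \<Rightarrow> real) \<Rightarrow> ereal \<Rightarrow> real" where
  "discounted_renewal M \<alpha> \<theta> R t =
     (LINT s:{s. 0 \<le> s \<and> ereal s \<le> t}|renewal_measure M \<theta>. exp (s * laplace_exponent M R \<alpha>))"

definition tail_approx ::
  "'a measure \<Rightarrow> nat \<Rightarrow> nat \<Rightarrow> real \<Rightarrow> (nat \<Rightarrow> nat \<Rightarrow> real \<Rightarrow> real)
    \<Rightarrow> (nat \<Rightarrow> nat \<Rightarrow> nat \<Rightarrow> 'a \<Rightarrow> real) \<Rightarrow> (real \<Rightarrow> 'a \<Rightarrow> real) \<Rightarrow> real \<Rightarrow> ereal \<Rightarrow> real" where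
  "tail_approx M d r \<alpha> claim_cdf \<theta> R x t =
     (\<Sum>k = 1..d. \<Sum>j = 1..r. (1 - claim_cdf k j x) * discounted_renewal M \<alpha> (\<theta> k j) R t)"

definition line_weight ::
  "'a measure \<Rightarrow> nat \<Rightarrow> real \<Rightarrow> (nat \<Rightarrow> nat \<Rightarrow> real)
    \<Rightarrow> (nat \<Rightarrow> nat \<Rightarrow> nat \<Rightarrow> 'a \<Rightarrow> real) \<Rightarrow> (real \<Rightarrow> 'a \<Rightarrow> real) \<Rightarrow> nat \<Rightarrow> ereal \<Rightarrow> real" where
  "line_weight M r \<alpha> a \<theta> R k t = (\<Sum>j = 1..r. a k j * discounted_renewal M \<alpha> (\<theta> k j) R t)"

text \<open>For positive line weights the next two quantities have the sign of the quantile of \<open>F\<close>, which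
  is nonnegative for \<open>0 < q < 1\<close> if \<open>F\<close> is concentrated on the nonnegative half-line, and for
  \<open>q\<close> near \<open>1\<close> if \<open>F\<close> is merely unbounded to the right. Where it is negative, every
  monotonicity in the line weights is reversed.\<close>

definition SES_approx ::
  "'a measure \<Rightarrow> nat \<Rightarrow> nat \<Rightarrow> real \<Rightarrow> (real \<Rightarrow> real) \<Rightarrow> (nat \<Rightarrow> nat \<Rightarrow> real)
    \<Rightarrow> (nat \<Rightarrow> nat \<Rightarrow> nat \<Rightarrow> 'a \<Rightarrow> real) \<Rightarrow> (real \<Rightarrow> 'a \<Rightarrow> real) \<Rightarrow> real \<Rightarrow> nat \<Rightarrow> ereal \<Rightarrow> real" where
  "SES_approx M d r \<alpha> F a \<theta> R q k t =
     (let l = (\<lambda>i. line_weight M r \<alpha> a \<theta> R i t); L = (\<Sum>i = 1..d. l i)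
      in l k / L * (L powr (1 / \<alpha>) - l k powr (1 / \<alpha>) + L powr (1 / \<alpha>) / (\<alpha> - 1))
           * generalized_inverse F q)"

definition MES_approx ::
  "'a measure \<Rightarrow> nat \<Rightarrow> nat \<Rightarrow> real \<Rightarrow> (real \<Rightarrow> real) \<Rightarrow> (nat \<Rightarrow> nat \<Rightarrow> real)
    \<Rightarrow> (nat \<Rightarrow> nat \<Rightarrow> nat \<Rightarrow> 'a \<Rightarrow> real) \<Rightarrow> (real \<Rightarrow> 'a \<Rightarrow> real) \<Rightarrow> real \<Rightarrow> nat \<Rightarrow> ereal \<Rightarrow> real" where
  "MES_approx M d r \<alpha> F a \<theta> R q k t =
     (let l = (\<lambda>i. line_weight M r \<alpha> a \<theta> R i t); L = (\<Sum>i = 1..d. l i)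
      in \<alpha> / (\<alpha> - 1) * (l k / L powr (1 - 1 / \<alpha>)) * generalized_inverse F q)"

section \<open>Poisson arrivals and jump-diffusion returns\<close>

text \<open>\<open>lam k j\<close> are the claim arrival intensities and \<open>\<nu>\<close> is the jump intensity of the investment
  returns (for \<open>\<nu> = 0\<close> there are almost surely no jumps). In the last assumption a non-integrable
  \<open>R 1\<close>, or a non-integrable exponential of it, would be given the junk value \<open>0\<close>, which the strict
  inequalities exclude.\<close>

locale poisson_jump_diffusion_model =
  renewal_risk_model M d r claim_cdf c X \<theta> R
  for M :: "'a measure" and d r claim_cdf c X \<theta> R +
  fixes \<alpha> :: real
    and F :: "real \<Rightarrow> real"
    and a lam :: "nat \<Rightarrow> nat \<Rightarrow> real"
    and \<mu> \<sigma> \<nu> :: real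
    and W :: "real \<Rightarrow> 'a \<Rightarrow> real"
    and \<zeta> :: "nat \<Rightarrow> 'a \<Rightarrow> real"
    and N' :: "real \<Rightarrow> 'a \<Rightarrow> nat"
  assumes alpha: "\<alpha> > 1"
    and claim_tail: "\<lbrakk>k \<in> {1..d}; j \<in> {1..r}\<rbrakk> \<Longrightarrow> regularly_varying_tail (claim_cdf k j) \<alpha>"
    and reference_cdf: "distribution_function F"
    and tail_coeff: "\<lbrakk>k \<in> {1..d}; j \<in> {1..r}\<rbrakk> \<Longrightarrow> a k j > 0"
    and tail_equiv: "\<lbrakk>k \<in> {1..d}; j \<in> {1..r}\<rbrakk> \<Longrightarrow>
      (\<lambda>x. 1 - claim_cdf k j x) \<sim>[at_top] (\<lambda>x. a k j * (1 - F x))"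
    and intensity: "\<lbrakk>k \<in> {1..d}; j \<in> {1..r}\<rbrakk> \<Longrightarrow> lam k j > 0"
    and arrivals: "\<lbrakk>k \<in> {1..d}; j \<in> {1..r}\<rbrakk> \<Longrightarrow>
      homogeneous_poisson_process M (lam k j) (\<lambda>t. arrival_count (\<theta> k j) (ereal t))"
    and drift: "\<mu> \<ge> 0"
    and volatility: "\<sigma> \<ge> 0"
    and brownian: "standard_brownian_motion M W"
    and jump_sizes_indep: "indep_vars (\<lambda>_. borel) \<zeta> {1..}"
    and jump_sizes_normal: "i \<ge> 1 \<Longrightarrow> distributed M lborel (\<zeta> i) std_normal_density"
    and jump_times: "homogeneous_poisson_process M \<nu> (\<lambda>t \<omega>. enat (N' t \<omega>))"
    and components_indep:
      "indep_sets (\<lambda>g. [generated_events M borel (\<lambda>(k, j, i). X k j i) ({1..d} \<times> {1..r} \<times> {1..}),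
                         generated_events M borel (\<lambda>(k, j, i). \<theta> k j i) ({1..d} \<times> {1..r} \<times> {1..}),
                         generated_events M borel W {0..},
                         generated_events M borel \<zeta> {1..},
                         generated_events M (count_space UNIV) N' {0..}] ! g) {..<5}"
    and return_process: "\<lbrakk>t \<ge> 0; \<omega> \<in> space M\<rbrakk> \<Longrightarrow>
      R t \<omega> = \<mu> * t + \<sigma> * W t \<omega> + (\<Sum>i = 1..N' t \<omega>. \<zeta> i \<omega>)"
    and mean_return: "(\<integral>\<omega>. R 1 \<omega> \<partial>M) > 0"
    and net_profit: "\<exists>\<alpha>'>\<alpha>. laplace_exponent M R \<alpha>' < 0"

end

theory Submission
  imports Defs
begin

text \<open>Conditioning on the number of jumps gives the Laplace exponent
  \<open>\<phi> = - \<alpha>\<mu> + \<alpha>\<^sup>2\<sigma>\<^sup>2 / 2 + \<nu> (exp (\<alpha>\<^sup>2 / 2) - 1)\<close>, which for \<open>\<alpha> > 0\<close> is strictly decreasing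
  in \<open>\<mu>\<close> and strictly increasing in \<open>\<sigma> \<ge> 0\<close> and in \<open>\<nu>\<close>. For Poisson arrivals the Stieltjes measure of
  the renewal function is \<open>lam k j\<close> times Lebesgue measure on the half-line, so all discounted renewal
  integrals are multiples of the single integral \<open>I = \<integral> exp (s\<phi>) ds\<close> over \<open>0 \<le> s \<le> t\<close>. Hence the tail
  approximation is a positive multiple of \<open>I\<close>, and the two risk measures are positive multiples of
  \<open>I powr (1 / \<alpha>)\<close> times the quantile of \<open>F\<close>. Since \<open>\<phi> < 0\<close>, the integral is finite also for
  \<open>t = \<infinity>\<close> and strictly increasing in \<open>\<phi>\<close>.\<close>

section \<open>Gaussian and Poisson laws\<close>

text \<open>Completing the square: tilting the standard normal density by \<open>exp (b * x)\<close>
  gives \<open>exp (b\<^sup>2 / 2)\<close> times the normal density with mean \<open>b\<close>,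
  whose mass is 1.\<close>

lemma nn_integral_std_normal_exp:
  "(\<integral>\<^sup>+x. ennreal (std_normal_density x) * ennreal (exp (b * x)) \<partial>lborel) = ennreal (exp (b\<^sup>2 / 2))"
proof -
  have shift: "std_normal_density x * exp (b * x) = exp (b\<^sup>2 / 2) * normal_density b 1 x" for x
    by (simp add: normal_density_def exp_add[symmetric] power2_eq_square field_simps)
  have "(\<integral>\<^sup>+x. ennreal (std_normal_density x) * ennreal (exp (b * x)) \<partial>lborel)
      = (\<integral>\<^sup>+x. ennreal (exp (b\<^sup>2 / 2)) * ennreal (normal_density b 1 x) \<partial>lborel)"
    by (intro nn_integral_cong) (simp add: ennreal_mult[symmetric] shift)
  also have "\<dots> = ennreal (exp (b\<^sup>2 / 2)) * (\<integral>\<^sup>+x. ennreal (normal_density b 1 x) \<partial>lborel)"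
    by (rule nn_integral_cmult) simp
  also have "(\<integral>\<^sup>+x. ennreal (normal_density b 1 x) \<partial>lborel) = 1"
    using prob_space.emeasure_space_1[OF prob_space_normal_density[of 1 b]]
    by (simp add: emeasure_density)
  finally show ?thesis by simp
qed

lemma nn_integral_exp_std_normal:
  assumes "distributed M lborel Y std_normal_density"
  shows "(\<integral>\<^sup>+\<omega>. ennreal (exp (b * Y \<omega>)) \<partial>M) = ennreal (exp (b\<^sup>2 / 2))"
  using distributed_nn_integral[OF assms, of "\<lambda>x. ennreal (exp (b * x))"]
  by (simp add: nn_integral_std_normal_exp)

lemma poisson_sums:
  "(\<lambda>m. z ^ m / fact m * exp (- z)) sums (1::real)"
proof -
  have "(\<lambda>m. z ^ m / fact m) sums exp z"
    using exp_converges[of z] by (simp add: divide_inverse mult.commute)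
  from sums_mult2[OF this, of "exp (- z)"] show ?thesis
    by (simp add: exp_minus)
qed

text \<open>This is the probability generating function of the Poisson law. It later sums over the
  number of jumps, with \<open>y\<close> the exponential moment of a single jump.\<close>

lemma poisson_generating_sums:
  "(\<lambda>m. z ^ m / fact m * exp (- z) * y ^ m) sums (exp (z * (y - 1)) :: real)"
proof -
  have "(\<lambda>m. (z * y) ^ m / fact m) sums exp (z * y)"
    using exp_converges[of "z * y"] by (simp add: divide_inverse mult.commute)
  from sums_mult2[OF this, of "exp (- z)"] show ?thesis
    by (simp add: power_mult_distrib exp_add[symmetric] right_diff_distrib mult_ac)
qed

lemma poisson_mean_sums:
  "(\<lambda>m. z ^ m / fact m * exp (- z) * real m) sums (z::real)"
proof -
  \<comment> \<open>The factor \<open>Suc m\<close> cancels against the factorial, which shifts the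
    series by one and leaves \<open>z\<close> times the total mass. The term at 0 split off by the
    shift is zero.\<close>
  have "z ^ Suc m / fact (Suc m) * exp (- z) * real (Suc m) = z ^ m / fact m * exp (- z) * z" for m
    by (simp add: field_simps del: of_nat_Suc)
  with sums_mult2[OF poisson_sums[of z], of z]
  have "(\<lambda>m. z ^ Suc m / fact (Suc m) * exp (- z) * real (Suc m)) sums z"
    by (simp only: mult_1_left)
  then show ?thesis
    by (subst (asm) sums_Suc_iff) simp
qed

text \<open>A priori \<open>N\<close> may take the value infinity. The probabilities of the finite
  values already sum to 1, so infinity has probability zero and the mean is a series over the finite
  values.\<close>

lemma (in prob_space) nn_integral_poisson:
  fixes N :: "'a \<Rightarrow> enat"
  assumes N: "N \<in> M \<rightarrow>\<^sub>M count_space UNIV" and "0 \<le> z"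
    and law: "\<And>m. measure M {\<omega> \<in> space M. N \<omega> = enat m} = z ^ m / fact m * exp (- z)"
  shows "(\<integral>\<^sup>+\<omega>. ennreal_of_enat (N \<omega>) \<partial>M) = ennreal z"
proof -
  have S: "{\<omega> \<in> space M. N \<omega> = enat m} \<in> sets M" for m
    using measurable_sets[OF N, of "{enat m}"] by (simp add: vimage_def Int_def conj_commute)
  have D: "disjoint_family (\<lambda>m. {\<omega> \<in> space M. N \<omega> = enat m})"
    by (auto simp: disjoint_family_on_def)
  have "(\<lambda>m. measure M {\<omega> \<in> space M. N \<omega> = enat m}) sums measure M (\<Union>m. {\<omega> \<in> space M. N \<omega> = enat m})"
    using S D by (intro finite_measure_UNION) auto
  then have "measure M (\<Union>m. {\<omega> \<in> space M. N \<omega> = enat m}) = 1"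
    using poisson_sums[of z] by (simp add: law sums_iff)
  then have "AE \<omega> in M. \<omega> \<in> (\<Union>m. {\<omega> \<in> space M. N \<omega> = enat m})"
    using S by (subst prob_eq_1[symmetric]) auto
  then have "AE \<omega> in M. ennreal_of_enat (N \<omega>)
      = (\<Sum>m. ennreal (real m) * indicator {\<omega> \<in> space M. N \<omega> = enat m} \<omega>)"
  proof eventually_elim
    case (elim \<omega>)
    then obtain n where n: "\<omega> \<in> space M" "N \<omega> = enat n" by auto
    have "(\<Sum>m. ennreal (real m) * indicator {\<omega> \<in> space M. N \<omega> = enat m} \<omega>)
        = (\<Sum>m\<in>{n}. ennreal (real m) * indicator {\<omega> \<in> space M. N \<omega> = enat m} \<omega>)"
      using n by (intro suminf_finite) (auto simp: indicator_def)
    then show ?case using n by (simp add: ennreal_of_nat_eq_real_of_nat)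
  qed
  then have "(\<integral>\<^sup>+\<omega>. ennreal_of_enat (N \<omega>) \<partial>M)
      = (\<integral>\<^sup>+\<omega>. (\<Sum>m. ennreal (real m) * indicator {\<omega> \<in> space M. N \<omega> = enat m} \<omega>) \<partial>M)"
    by (rule nn_integral_cong_AE)
  also have "\<dots> = (\<Sum>m. \<integral>\<^sup>+\<omega>. ennreal (real m) * indicator {\<omega> \<in> space M. N \<omega> = enat m} \<omega> \<partial>M)"
    using S by (intro nn_integral_suminf) auto
  also have "\<dots> = (\<Sum>m. ennreal (z ^ m / fact m * exp (- z) * real m))"
    using S \<open>0 \<le> z\<close>
    by (intro suminf_cong)
       (simp add: nn_integral_cmult emeasure_eq_measure law ennreal_mult[symmetric] mult.commute)
  also have "\<dots> = ennreal z"
    using poisson_mean_sums[of z] \<open>0 \<le> z\<close> by (intro suminf_ennreal_eq) auto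
  finally show ?thesis .
qed

text \<open>The process is specified through its increments. Since \<open>N 0\<close> vanishes
  almost surely, the increment from 0 to \<open>t\<close> has the law of \<open>N t\<close>
  itself.\<close>

lemma (in prob_space) homogeneous_poisson_process_law:
  assumes P: "homogeneous_poisson_process M rate N" and t: "0 \<le> t"
  shows "measure M {\<omega> \<in> space M. N t \<omega> = enat m} = (rate * t) ^ m / fact m * exp (- (rate * t))"
proof -
  have N [measurable]: "N t \<in> M \<rightarrow>\<^sub>M count_space UNIV" "N 0 \<in> M \<rightarrow>\<^sub>M count_space UNIV"
    and N0: "AE \<omega> in M. N 0 \<omega> = 0"
    and law: "measure M {\<omega> \<in> space M. N t \<omega> - N 0 \<omega> = enat m}
      = (rate * (t - 0)) ^ m / fact m * exp (- (rate * (t - 0)))"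
    using P t unfolding homogeneous_poisson_process_def by blast+
  have "measure M {\<omega> \<in> space M. N t \<omega> - N 0 \<omega> = enat m} = measure M {\<omega> \<in> space M. N t \<omega> = enat m}"
    using N0 by (intro measure_eq_AE) auto
  with law show ?thesis by simp
qed

section \<open>Stieltjes integrals against a linear renewal function\<close>

text \<open>Both measures agree on the half-open intervals, an intersection-stable generator of the
  Borel sets, and countably many such intervals of finite measure cover the line.\<close>

lemma interval_measure_linear:
  assumes "0 \<le> (b::real)"
  shows "interval_measure (\<lambda>s. b * max 0 s) = density lborel (\<lambda>s. ennreal (b * indicator {0..} s))"
    (is "?I = ?D")
proof (rule measure_eqI_generator_eq[where E = "range (\<lambda>(x, y). {x<..y::real})" and \<Omega> = UNIV
      and A = "\<lambda>n. {- real n<..real n}"])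
  have I: "emeasure ?I {x<..y} = ennreal (b * max 0 y - b * max 0 x)" if "x \<le> y" for x y
  proof (rule emeasure_interval_measure_Ioc[OF that])
    show "\<And>x y. x \<le> y \<Longrightarrow> b * max 0 x \<le> b * max 0 y"
      using assms by (intro mult_left_mono) auto
    show "continuous (at_right a) (\<lambda>s. b * max 0 s)" for a
      by (intro continuous_intros)
  qed
  have D: "emeasure ?D {x<..y} = ennreal (b * max 0 y - b * max 0 x)" if "x \<le> y" for x y
  proof -
    have "emeasure ?D {x<..y} = (\<integral>\<^sup>+s. ennreal b * indicator ({0..} \<inter> {x<..y}) s \<partial>lborel)"
      by (subst emeasure_density) (auto intro!: nn_integral_cong simp: indicator_def)
    also have "\<dots> = ennreal b * emeasure lborel ({0..} \<inter> {x<..y})"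
      by (subst nn_integral_cmult_indicator) auto
    also have "emeasure lborel ({0..} \<inter> {x<..y}) = ennreal (max 0 y - max 0 x)"
    proof -
      \<comment> \<open>The position of the interval relative to the origin decides which part of it
        meets the half-line.\<close>
      consider "0 \<le> x" | "x < 0" "0 \<le> y" | "y < 0" by linarith
      then show ?thesis
      proof cases
        case 1
        then have "{0..} \<inter> {x<..y} = {x<..y}" by auto
        with 1 that show ?thesis by simp
      next
        case 2
        then have "{0..} \<inter> {x<..y} = {0..y}" by auto
        with 2 show ?thesis by simp
      next
        case 3
        then have "{0..} \<inter> {x<..y} = {}" by auto
        with 3 that show ?thesis by simp
      qed
    qed
    finally show ?thesis
      using assms that by (simp add: ennreal_mult[symmetric] right_diff_distrib)
  qed
  show "Int_stable (range (\<lambda>(x, y). {x<..y::real}))"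
  proof (rule Int_stableI_image)
    fix p q :: "real \<times> real"
    show "\<exists>w\<in>UNIV. (case p of (x, y) \<Rightarrow> {x<..y}) \<inter> (case q of (x, y) \<Rightarrow> {x<..y})
        = (case w of (x, y) \<Rightarrow> {x<..y})"
      by (rule bexI[where x = "(max (fst p) (fst q), min (snd p) (snd q))"])
         (auto simp: split_beta)
  qed
  show "emeasure ?I X = emeasure ?D X" if X_in: "X \<in> range (\<lambda>(x, y). {x<..y::real})" for X
  proof -
    obtain x y where X: "X = {x<..y}" using X_in by auto
    show ?thesis
      by (cases "x \<le> y") (simp_all add: X I D)
  qed
  show "sets ?I = sigma_sets UNIV (range (\<lambda>(x, y). {x<..y::real}))"
    by (simp add: borel_sigma_sets_Ioc)
  show "sets ?D = sigma_sets UNIV (range (\<lambda>(x, y). {x<..y::real}))"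
    by (simp add: borel_sigma_sets_Ioc)
  show "(\<Union>n. {- real n<..real n}) = (UNIV :: real set)"
  proof safe
    fix x :: real
    obtain n where "\<bar>x\<bar> < real n" using reals_Archimedean2 by blast
    then show "x \<in> (\<Union>n. {- real n<..real n})" by (intro UN_I[of n]) auto
  qed auto
  show "emeasure ?I {- real n<..real n} \<noteq> \<infinity>" for n
    by (subst I) auto
qed auto

section \<open>The discount integral: finiteness, positivity and strict monotonicity\<close>

definition discount_integral :: "real \<Rightarrow> ereal \<Rightarrow> real" where
  "discount_integral \<phi> t = (LINT s:{s. 0 \<le> s \<and> ereal s \<le> t}|lborel. exp (s * \<phi>))"

text \<open>On the half-line the integrand is the exponential density with rate
  \<open>- \<phi>\<close> divided by \<open>- \<phi>\<close>, so the case
  \<open>t = \<infinity>\<close> is covered as well.\<close>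

lemma set_integrable_discount:
  assumes "\<phi> < 0"
  shows "set_integrable lborel {s. 0 \<le> s \<and> ereal s \<le> t} (\<lambda>s. exp (s * \<phi>))"
proof -
  have "(\<integral>\<^sup>+s. ennreal (exponential_density (- \<phi>) s) \<partial>lborel) = 1"
    using prob_space.emeasure_space_1[OF prob_space_exponential_density[of "- \<phi>"]] assms
    by (simp add: emeasure_density)
  then have "integrable lborel (exponential_density (- \<phi>))"
    using assms by (intro integrableI_nonneg) (auto intro!: AE_I2 exponential_density_nonneg)
  then have "integrable lborel (\<lambda>s. exponential_density (- \<phi>) s / (- \<phi>))"
    by (rule integrable_divide)
  \<comment> \<open>The density vanishes for negative \<open>s\<close>, so it remains to cut at
    \<open>t\<close>.\<close>
  then have "set_integrable lborel {s. ereal s \<le> t} (\<lambda>s. exponential_density (- \<phi>) s / (- \<phi>))"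
    unfolding set_integrable_def by (rule integrable_mult_indicator[rotated]) simp
  then show ?thesis
    unfolding set_integrable_def
    by (rule Bochner_Integration.integrable_cong[THEN iffD1, rotated -1])
       (use assms in \<open>auto simp: exponential_density_def indicator_def mult.commute\<close>)
qed

text \<open>The difference \<open>h\<close> of the integrands is nonnegative, and positive on an
  interval of positive length. A vanishing integral would force \<open>h\<close> to be zero almost
  everywhere.\<close>

lemma discount_integral_strict_mono:
  assumes "0 < t" "\<phi> < \<psi>" "\<psi> < 0"
  shows "discount_integral \<phi> t < discount_integral \<psi> t"
proof -
  let ?T = "{s. 0 \<le> s \<and> ereal s \<le> t}"
  \<comment> \<open>Since \<open>t\<close> may be infinite, a finite positive \<open>u\<close> not
    exceeding it is chosen. The interval \<open>{0<..u}\<close> used below leaves out 0, where both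
    integrands equal 1.\<close>
  obtain u where u: "0 < u" "ereal u \<le> t"
    using assms(1) by (metis ereal_dense2 ereal_less(2) less_imp_le)
  define h where "h s = indicator ?T s *\<^sub>R exp (s * \<psi>) - indicator ?T s *\<^sub>R exp (s * \<phi>)" for s
  have int: "integrable lborel (\<lambda>s. indicator ?T s *\<^sub>R exp (s * \<phi>))"
    "integrable lborel (\<lambda>s. indicator ?T s *\<^sub>R exp (s * \<psi>))"
    using set_integrable_discount assms unfolding set_integrable_def by auto
  then have h: "integrable lborel h"
    unfolding h_def by (intro Bochner_Integration.integrable_diff)
  have nonneg: "0 \<le> h s" for s
    using assms by (auto simp: h_def indicator_def mult_left_mono)
  have pos: "0 < h s" if "s \<in> {0<..u}" for s
    using that u assms order_trans[of "ereal s" "ereal u" t] by (auto simp: h_def indicator_def)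
  have "integral\<^sup>L lborel h \<noteq> 0"
  proof
    assume "integral\<^sup>L lborel h = 0"
    then have "AE s in lborel. h s = 0"
      using integral_nonneg_eq_0_iff_AE[OF h] nonneg by simp
    then have "AE s in lborel. s \<notin> {0<..u}"
      by eventually_elim (use pos in force)
    then have "emeasure lborel {0<..u} = 0"
      by (subst (asm) AE_iff_measurable[OF _ refl]) (auto simp: greaterThanAtMost_def greaterThan_def atMost_def Int_def)
    with u show False by simp
  qed
  moreover have "0 \<le> integral\<^sup>L lborel h"
    using nonneg by (intro integral_nonneg_AE AE_I2)
  moreover have "integral\<^sup>L lborel h = discount_integral \<psi> t - discount_integral \<phi> t"
    unfolding h_def discount_integral_def set_lebesgue_integral_def
    using int by (intro Bochner_Integration.integral_diff)
  ultimately show ?thesis by linarith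
qed

lemma discount_integral_nonneg: "0 \<le> discount_integral \<phi> t"
  unfolding discount_integral_def set_lebesgue_integral_def
  by (intro integral_nonneg_AE AE_I2) (auto simp: indicator_def)

text \<open>Strict comparison with the exponent \<open>\<phi> - 1\<close>, whose integral is at
  least 0.\<close>

lemma discount_integral_pos:
  assumes "0 < t" "\<phi> < 0"
  shows "0 < discount_integral \<phi> t"
  using discount_integral_strict_mono[OF assms(1), of "\<phi> - 1" \<phi>] assms
    discount_integral_nonneg[of "\<phi> - 1" t] by simp

section \<open>The jump-diffusion model\<close>

text \<open>The three terms are the contributions of the drift, the Brownian part and the compound
  Poisson part; \<open>exp (b\<^sup>2 / 2)\<close> is the exponential moment of one standard normal
  jump.\<close>

definition jump_diffusion_exponent :: "real \<Rightarrow> real \<Rightarrow> real \<Rightarrow> real \<Rightarrow> real" where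
  "jump_diffusion_exponent \<mu> \<sigma> \<nu> b = - b * \<mu> + (b * \<sigma>)\<^sup>2 / 2 + \<nu> * (exp (b\<^sup>2 / 2) - 1)"

text \<open>The second hypothesis is measurability of \<open>Y\<close> with respect to the sigma-algebra generated by
  the \<open>Z i\<close>, in a form in which the measurability automation can discharge it.\<close>

lemma sigma_sets_vimage_subset_generated_events:
  assumes Z: "\<And>i. i \<in> I \<Longrightarrow> Z i \<in> space M \<rightarrow> space S"
    and Y: "\<And>G. sets G = generated_events M S Z I \<Longrightarrow> space G = space M \<Longrightarrow>
      (\<And>i. i \<in> I \<Longrightarrow> Z i \<in> G \<rightarrow>\<^sub>M S) \<Longrightarrow> Y \<in> G \<rightarrow>\<^sub>M T"
  shows "sigma_sets (space M) {Y -` A \<inter> space M | A. A \<in> sets T} \<subseteq> generated_events M S Z I"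
proof -
  let ?E = "\<Union>i\<in>I. {Z i -` A \<inter> space M | A. A \<in> sets S}"
  define G where "G = sigma (space M) ?E"
  have E: "?E \<subseteq> Pow (space M)" by auto
  have sets_G: "sets G = generated_events M S Z I" and space_G: "space G = space M"
    unfolding G_def generated_events_def using E by (simp_all add: sets_measure_of space_measure_of)
  have "Z i \<in> G \<rightarrow>\<^sub>M S" if "i \<in> I" for i
  proof (rule measurableI)
    show "\<And>x. x \<in> space G \<Longrightarrow> Z i x \<in> space S"
      using Z[OF that] by (auto simp: space_G)
    show "Z i -` A \<inter> space G \<in> sets G" if "A \<in> sets S" for A
      using that \<open>i \<in> I\<close> unfolding sets_G space_G generated_events_def
      by (intro sigma_sets.Basic) blast
  qed
  then have "Y \<in> G \<rightarrow>\<^sub>M T" by (intro Y sets_G space_G)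
  then have "{Y -` A \<inter> space M | A. A \<in> sets T} \<subseteq> sets G"
    by (auto simp flip: space_G intro: measurable_sets)
  from sets.sigma_sets_subset[OF this] show ?thesis
    by (simp add: sets_G space_G)
qed

context poisson_jump_diffusion_model
begin

section \<open>The Laplace exponent of the return process\<close>

lemma nn_integral_exp_brownian:
  "(\<integral>\<^sup>+\<omega>. ennreal (exp (b * W 1 \<omega>)) \<partial>M) = ennreal (exp (b\<^sup>2 / 2))"
proof -
  have W0: "AE \<omega> in M. W 0 \<omega> = 0"
    and law: "distributed M lborel (\<lambda>\<omega>. W 1 \<omega> - W 0 \<omega>) (normal_density 0 (sqrt (1 - 0)))"
    using brownian unfolding standard_brownian_motion_def by (blast, metis order_refl zero_less_one)
  have "(\<integral>\<^sup>+\<omega>. ennreal (exp (b * W 1 \<omega>)) \<partial>M) = (\<integral>\<^sup>+\<omega>. ennreal (exp (b * (W 1 \<omega> - W 0 \<omega>))) \<partial>M)"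
    using W0 by (intro nn_integral_cong_AE) auto
  also have "\<dots> = ennreal (exp (b\<^sup>2 / 2))"
    using law by (intro nn_integral_exp_std_normal) simp
  finally show ?thesis .
qed

lemma nn_integral_exp_jumps:
  "(\<integral>\<^sup>+\<omega>. (\<Prod>i = 1..n. ennreal (exp (b * \<zeta> i \<omega>))) \<partial>M) = ennreal (exp (b\<^sup>2 / 2) ^ n)"
proof -
  have "indep_vars (\<lambda>_. borel) \<zeta> {1..n}"
    using jump_sizes_indep by (rule indep_vars_subset) auto
  then have "indep_vars (\<lambda>_. borel) (\<lambda>i \<omega>. ennreal (exp (b * \<zeta> i \<omega>))) {1..n}"
    by (rule indep_vars_compose2) auto
  then have "(\<integral>\<^sup>+\<omega>. (\<Prod>i = 1..n. ennreal (exp (b * \<zeta> i \<omega>))) \<partial>M)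
      = (\<Prod>i = 1..n. \<integral>\<^sup>+\<omega>. ennreal (exp (b * \<zeta> i \<omega>)) \<partial>M)"
    by (intro indep_vars_nn_integral) auto
  also have "\<dots> = (\<Prod>i = 1..n. ennreal (exp (b\<^sup>2 / 2)))"
    using jump_sizes_normal by (intro prod.cong refl nn_integral_exp_std_normal) auto
  also have "\<dots> = ennreal (exp (b\<^sup>2 / 2) ^ n)"
    by (simp add: ennreal_power)
  finally show ?thesis .
qed

text \<open>Brownian motion, jump sizes and jump count are independent, so the integral over the
  event of exactly \<open>n\<close> jumps factorises. The parameters \<open>b\<close> and
  \<open>e\<close> are kept apart because the Brownian term will carry the extra factor
  \<sigma>.\<close>

lemma nn_integral_exp_diffusion_jumps:
  "(\<integral>\<^sup>+\<omega>. ennreal (exp (b * W 1 \<omega>)) * (\<Prod>i = 1..n. ennreal (exp (e * \<zeta> i \<omega>)))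
       * indicator {\<omega> \<in> space M. N' 1 \<omega> = n} \<omega> \<partial>M)
     = ennreal (exp (b\<^sup>2 / 2) * (\<nu> ^ n / fact n * exp (- \<nu>) * exp (e\<^sup>2 / 2) ^ n))"
proof -
  have N: "(\<lambda>\<omega>. enat (N' 1 \<omega>)) \<in> M \<rightarrow>\<^sub>M count_space UNIV" and W: "W 1 \<in> borel_measurable M"
    and nu: "0 \<le> \<nu>"
    using jump_times brownian
    unfolding homogeneous_poisson_process_def standard_brownian_motion_def by auto
  have z [measurable]: "\<zeta> i \<in> borel_measurable M" if "i \<in> {1..n}" for i
    using distributed_measurable[OF jump_sizes_normal[of i]] that by auto
  have S [measurable]: "{\<omega> \<in> space M. N' 1 \<omega> = n} \<in> sets M"
    using measurable_sets[OF N, of "{enat n}"] by (simp add: vimage_def Int_def conj_commute)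
  have p: "emeasure M {\<omega> \<in> space M. N' 1 \<omega> = n} = ennreal (\<nu> ^ n / fact n * exp (- \<nu>))"
    using homogeneous_poisson_process_law[OF jump_times, of 1 n] by (simp add: emeasure_eq_measure)
  \<comment> \<open>The indices 2, 3, 4 are the positions of \<open>W\<close>, \<open>\<zeta>\<close> and \<open>N'\<close> in the list of \<open>components_indep\<close>.\<close>
  define Y :: "nat \<Rightarrow> 'a \<Rightarrow> ennreal" where
    "Y g = (if g = 2 then (\<lambda>\<omega>. ennreal (exp (b * W 1 \<omega>)))
      else if g = 3 then (\<lambda>\<omega>. \<Prod>i = 1..n. ennreal (exp (e * \<zeta> i \<omega>)))
      else indicator {\<omega> \<in> space M. N' 1 \<omega> = n})" for g
  have "indep_vars (\<lambda>_. borel) Y {2, 3, 4}"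
    unfolding indep_vars_def
  proof (intro conjI ballI)
    show "random_variable borel (Y g)" for g
      using W S z by (auto simp: Y_def intro!: borel_measurable_prod)
    show "indep_sets (\<lambda>g. sigma_sets (space M) {Y g -` A \<inter> space M |A. A \<in> sets borel}) {2, 3, 4}"
    \<comment> \<open>Each \<open>Y g\<close> depends on one component only, so its sigma-algebra
      lies inside the events generated by that component, and independence passes to the smaller
      families.\<close>
    proof (rule indep_sets_mono[OF components_indep])
      have "sigma_sets (space M) {Y 2 -` A \<inter> space M |A. A \<in> sets borel}
          \<subseteq> generated_events M borel W {0..}"
        by (rule sigma_sets_vimage_subset_generated_events) (auto simp: Y_def)
      moreover have "sigma_sets (space M) {Y 3 -` A \<inter> space M |A. A \<in> sets borel}
          \<subseteq> generated_events M borel \<zeta> {1..}"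
        by (rule sigma_sets_vimage_subset_generated_events)
           (auto simp: Y_def intro!: borel_measurable_prod)
      moreover have "sigma_sets (space M) {Y 4 -` A \<inter> space M |A. A \<in> sets borel}
          \<subseteq> generated_events M (count_space UNIV) N' {0..}"
      proof (rule sigma_sets_vimage_subset_generated_events)
        fix G assume G: "space G = space M" "\<And>t. t \<in> {0..} \<Longrightarrow> N' t \<in> G \<rightarrow>\<^sub>M count_space UNIV"
        have "N' 1 -` {n} \<inter> space G \<in> sets G"
          using G(2)[of 1] by (intro measurable_sets) auto
        then have "{\<omega> \<in> space M. N' 1 \<omega> = n} \<in> sets G"
          by (simp add: G(1) vimage_def Int_def conj_commute)
        then show "Y 4 \<in> G \<rightarrow>\<^sub>M borel"
          by (simp add: Y_def)
      qed auto
      ultimately show "sigma_sets (space M) {Y g -` A \<inter> space M |A. A \<in> sets borel}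
          \<subseteq> [generated_events M borel (\<lambda>(k, j, i). X k j i) ({1..d} \<times> {1..r} \<times> {1..}),
              generated_events M borel (\<lambda>(k, j, i). \<theta> k j i) ({1..d} \<times> {1..r} \<times> {1..}),
              generated_events M borel W {0..}, generated_events M borel \<zeta> {1..},
              generated_events M (count_space UNIV) N' {0..}] ! g" if "g \<in> {2, 3, 4}" for g
        using that by (elim insertE) (simp_all add: numeral_eq_Suc)
    qed auto
  qed
  then have "(\<integral>\<^sup>+\<omega>. (\<Prod>g\<in>{2, 3, 4}. Y g \<omega>) \<partial>M) = (\<Prod>g\<in>{2, 3, 4}. \<integral>\<^sup>+\<omega>. Y g \<omega> \<partial>M)"
    by (intro indep_vars_nn_integral) auto
  then show ?thesis
    using nu S
    by (simp add: Y_def nn_integral_exp_brownian nn_integral_exp_jumps p ennreal_mult[symmetric] mult_ac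
        del: One_nat_def)
qed

text \<open>The space is decomposed by the number of jumps up to time 1. All terms are nonnegative,
  so series and integral may be interchanged.\<close>

lemma nn_integral_exp_return:
  "(\<integral>\<^sup>+\<omega>. ennreal (exp (- b * R 1 \<omega>)) \<partial>M) = ennreal (exp (jump_diffusion_exponent \<mu> \<sigma> \<nu> b))"
proof -
  let ?f = "\<lambda>n \<omega>. ennreal (exp (- b * \<sigma> * W 1 \<omega>)) * (\<Prod>i = 1..n. ennreal (exp (- b * \<zeta> i \<omega>)))
       * indicator {\<omega> \<in> space M. N' 1 \<omega> = n} \<omega>"
  have N: "(\<lambda>\<omega>. enat (N' 1 \<omega>)) \<in> M \<rightarrow>\<^sub>M count_space UNIV" and W: "W 1 \<in> borel_measurable M"
    and nu: "0 \<le> \<nu>"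
    using jump_times brownian
    unfolding homogeneous_poisson_process_def standard_brownian_motion_def by auto
  have z: "\<zeta> i \<in> borel_measurable M" if "1 \<le> i" for i
    using distributed_measurable[OF jump_sizes_normal[OF that]] by simp
  have S: "{\<omega> \<in> space M. N' 1 \<omega> = n} \<in> sets M" for n
    using measurable_sets[OF N, of "{enat n}"] by (simp add: vimage_def Int_def conj_commute)
  have f: "?f n \<in> borel_measurable M" for n
    using W z S[of n] by (intro borel_measurable_times_ennreal borel_measurable_prod_ennreal) auto
  have split: "ennreal (exp (- b * R 1 \<omega>)) = ennreal (exp (- b * \<mu>)) * (\<Sum>n. ?f n \<omega>)"
    if "\<omega> \<in> space M" for \<omega>
  proof -
    \<comment> \<open>Only the term whose index is the actual number of jumps survives.\<close>
    have "(\<Sum>n. ?f n \<omega>) = (\<Sum>n\<in>{N' 1 \<omega>}. ?f n \<omega>)"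
      by (intro suminf_finite) (auto simp: indicator_def)
    also have "\<dots> = ennreal (exp (- b * \<sigma> * W 1 \<omega>) * (\<Prod>i = 1..N' 1 \<omega>. exp (- b * \<zeta> i \<omega>)))"
      using that by (simp add: prod_ennreal ennreal_mult prod_nonneg)
    finally show ?thesis
      using that
      by (simp add: return_process ennreal_mult[symmetric] prod_nonneg exp_sum[symmetric]
          exp_add[symmetric] sum_distrib_left algebra_simps sum_negf)
  qed
  have "(\<integral>\<^sup>+\<omega>. ennreal (exp (- b * R 1 \<omega>)) \<partial>M)
      = (\<integral>\<^sup>+\<omega>. ennreal (exp (- b * \<mu>)) * (\<Sum>n. ?f n \<omega>) \<partial>M)"
    by (intro nn_integral_cong split)
  also have "\<dots> = ennreal (exp (- b * \<mu>)) * (\<integral>\<^sup>+\<omega>. (\<Sum>n. ?f n \<omega>) \<partial>M)"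
    using f by (intro nn_integral_cmult borel_measurable_suminf_order)
  also have "(\<integral>\<^sup>+\<omega>. (\<Sum>n. ?f n \<omega>) \<partial>M) = (\<Sum>n. \<integral>\<^sup>+\<omega>. ?f n \<omega> \<partial>M)"
    using f by (rule nn_integral_suminf)
  also have "(\<Sum>n. \<integral>\<^sup>+\<omega>. ?f n \<omega> \<partial>M) = (\<Sum>n. ennreal
      (exp ((- b * \<sigma>)\<^sup>2 / 2) * (\<nu> ^ n / fact n * exp (- \<nu>) * exp ((- b)\<^sup>2 / 2) ^ n)))"
    by (simp only: nn_integral_exp_diffusion_jumps)
  \<comment> \<open>The series over \<open>n\<close> is the Poisson generating function at
    \<open>exp ((- b)\<^sup>2 / 2)\<close>.\<close>
  also have "\<dots> = ennreal (exp ((- b * \<sigma>)\<^sup>2 / 2) * exp (\<nu> * (exp ((- b)\<^sup>2 / 2) - 1)))"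
    using nu by (intro suminf_ennreal_eq sums_mult poisson_generating_sums) auto
  finally show ?thesis
    by (simp add: jump_diffusion_exponent_def ennreal_mult[symmetric] exp_add[symmetric] add.assoc)
qed

text \<open>The nonnegative integral is finite and thus equals the Lebesgue integral inside the
  logarithm. An equality of functions is stated because it is used at \<alpha> and at the larger
  argument where the exponent is known to be negative.\<close>

lemma laplace_exponent_return: "laplace_exponent M R = jump_diffusion_exponent \<mu> \<sigma> \<nu>"
proof
  fix b
  have "R 1 \<in> borel_measurable M" by (rule return_rv) simp
  then have "(\<integral>\<omega>. exp (- b * R 1 \<omega>) \<partial>M) = exp (jump_diffusion_exponent \<mu> \<sigma> \<nu> b)"
    by (subst integral_eq_nn_integral) (simp_all only: nn_integral_exp_return, auto)
  then show "laplace_exponent M R b = jump_diffusion_exponent \<mu> \<sigma> \<nu> b"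
    by (simp add: laplace_exponent_def)
qed

text \<open>The exponent is convex in its argument and vanishes at \<open>0\<close>, so negativity at some
  \<open>\<alpha>' > \<alpha>\<close> carries over to \<open>\<alpha>\<close>; for the jump part this is the convexity of \<open>exp\<close>.\<close>

lemma exponent_neg: "jump_diffusion_exponent \<mu> \<sigma> \<nu> \<alpha> < 0"
proof -
  obtain b where b: "\<alpha> < b" and neg: "jump_diffusion_exponent \<mu> \<sigma> \<nu> b < 0"
    using net_profit unfolding laplace_exponent_return by blast
  define s where "s = \<alpha> / b"
  have s: "0 < s" "s \<le> 1" and a: "\<alpha> = s * b"
    using alpha b by (auto simp: s_def)
  have nu: "0 \<le> \<nu>"
    using jump_times unfolding homogeneous_poisson_process_def by auto
  \<comment> \<open>Passing from \<open>b\<close> to \<open>s * b\<close> multiplies the drift term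
    by exactly \<open>s\<close>, but the squares by \<open>s\<^sup>2\<close>, which is at most
    \<open>s\<close>.\<close>
  have ss: "s\<^sup>2 \<le> s"
    using s by (simp add: power2_eq_square mult_left_le)
  have "exp (\<alpha>\<^sup>2 / 2) \<le> exp (s * (b\<^sup>2 / 2))"
    using mult_right_mono[OF ss, of "b\<^sup>2"] by (simp add: a power_mult_distrib)
  also have "\<dots> \<le> (1 - s) * exp 0 + s * exp (b\<^sup>2 / 2)"
    using convex_onD[OF exp_convex, of s 0 "b\<^sup>2 / 2"] s by simp
  finally have "\<nu> * (exp (\<alpha>\<^sup>2 / 2) - 1) \<le> \<nu> * (s * (exp (b\<^sup>2 / 2) - 1))"
    using nu by (intro mult_left_mono) (auto simp: algebra_simps)
  moreover have "(\<alpha> * \<sigma>)\<^sup>2 / 2 \<le> s * ((b * \<sigma>)\<^sup>2 / 2)"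
    using mult_right_mono[OF ss, of "(b * \<sigma>)\<^sup>2"] by (simp add: a power_mult_distrib mult_ac)
  ultimately have "jump_diffusion_exponent \<mu> \<sigma> \<nu> \<alpha> \<le> s * jump_diffusion_exponent \<mu> \<sigma> \<nu> b"
    unfolding jump_diffusion_exponent_def by (simp add: a algebra_simps)
  also have "\<dots> < 0" using neg s by (simp add: mult_pos_neg)
  finally show ?thesis .
qed

section \<open>Renewal functions and discounted renewal integrals for Poisson arrivals\<close>

lemma renewal_function_neg:
  assumes "k \<in> {1..d}" "j \<in> {1..r}" "s < 0"
  shows "renewal_function M (\<theta> k j) (ereal s) = 0"
proof -
  have "AE \<omega> in M. \<forall>i\<in>{1..}. 0 \<le> \<theta> k j i \<omega>"
    using assms interarrival_nonneg by (subst AE_ball_countable) auto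
  then have "AE \<omega> in M. ennreal_of_enat (arrival_count (\<theta> k j) (ereal s) \<omega>) = 0"
  proof eventually_elim
    case (elim \<omega>)
    then have "0 \<le> arrival_time (\<theta> k j) m \<omega>" for m
      unfolding arrival_time_def by (intro sum_nonneg) auto
    \<comment> \<open>Even the zeroth arrival time, which is 0, exceeds the negative
      \<open>s\<close>. The set is therefore empty, and its supremum in \<open>enat\<close> is
      0.\<close>
    then have "{enat m |m. ereal (arrival_time (\<theta> k j) m \<omega>) \<le> ereal s} = {}"
      using assms(3) by (auto simp: not_le intro: less_le_trans)
    then show ?case by (simp add: arrival_count_def bot_enat_def)
  qed
  then show ?thesis
    unfolding renewal_function_def by (subst nn_integral_cong_AE) auto
qed

lemma renewal_function_nonneg:
  assumes "k \<in> {1..d}" "j \<in> {1..r}" "0 \<le> s"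
  shows "renewal_function M (\<theta> k j) (ereal s) = ennreal (lam k j * s)"
  unfolding renewal_function_def
proof (rule nn_integral_poisson)
  note P = arrivals[OF assms(1,2)]
  show "(\<lambda>\<omega>. arrival_count (\<theta> k j) (ereal s) \<omega>) \<in> M \<rightarrow>\<^sub>M count_space UNIV"
    using P assms(3) unfolding homogeneous_poisson_process_def by simp
  show "0 \<le> lam k j * s" using intensity[OF assms(1,2)] assms(3) by simp
  show "prob {\<omega> \<in> space M. arrival_count (\<theta> k j) (ereal s) \<omega> = enat m}
      = (lam k j * s) ^ m / fact m * exp (- (lam k j * s))" for m
    by (rule homogeneous_poisson_process_law[OF P assms(3)])
qed

text \<open>The renewal function is zero before the origin and linear after it, so its Stieltjes
  measure has the constant density \<open>lam k j\<close> on the half-line.\<close>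

lemma discounted_renewal_eq:
  assumes "k \<in> {1..d}" "j \<in> {1..r}"
  shows "discounted_renewal M \<alpha> (\<theta> k j) R t
    = lam k j * discount_integral (jump_diffusion_exponent \<mu> \<sigma> \<nu> \<alpha>) t"
proof -
  let ?\<phi> = "jump_diffusion_exponent \<mu> \<sigma> \<nu> \<alpha>"
  let ?T = "{s. 0 \<le> s \<and> ereal s \<le> t}"
  have lam: "0 \<le> lam k j" using intensity[OF assms] by simp
  have "(\<lambda>s. enn2real (renewal_function M (\<theta> k j) (ereal s))) = (\<lambda>s. lam k j * max 0 s)"
  proof
    fix s :: real
    show "enn2real (renewal_function M (\<theta> k j) (ereal s)) = lam k j * max 0 s"
      using lam renewal_function_neg[OF assms, of s] renewal_function_nonneg[OF assms, of s]
      by (cases "0 \<le> s") auto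
  qed
  then have "renewal_measure M (\<theta> k j) = density lborel (\<lambda>s. ennreal (lam k j * indicator {0..} s))"
    unfolding renewal_measure_def using interval_measure_linear[OF lam] by simp
  then have "discounted_renewal M \<alpha> (\<theta> k j) R t
      = (\<integral>s. (lam k j * indicator {0..} s) *\<^sub>R (indicator ?T s *\<^sub>R exp (s * ?\<phi>)) \<partial>lborel)"
    unfolding discounted_renewal_def laplace_exponent_return set_lebesgue_integral_def
    using lam by (simp only:) (rule integral_density, auto)
  \<comment> \<open>The indicator of the half-line is absorbed by that of \<open>?T\<close>, whose
    points are nonnegative.\<close>
  also have "\<dots> = (\<integral>s. lam k j * (indicator ?T s *\<^sub>R exp (s * ?\<phi>)) \<partial>lborel)"
    by (intro Bochner_Integration.integral_cong) (auto simp: indicator_def)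
  finally show ?thesis
    by (simp add: discount_integral_def set_lebesgue_integral_def)
qed

text \<open>The mean number of Poisson arrivals by time 0 is zero, which excludes
  \<open>t = 0\<close>. There is at least one line and one claim type to apply this to.\<close>

lemma time_set_pos:
  assumes "t \<in> time_set M d r \<theta>"
  shows "0 < t"
proof -
  have "1 \<in> {1..d}" "1 \<in> {1..r}" using lines_types by auto
  then have "0 \<le> t" "renewal_function M (\<theta> 1 1) t \<noteq> 0"
    using assms unfolding time_set_def by force+
  moreover have "renewal_function M (\<theta> 1 1) (ereal 0) = 0"
    using renewal_function_nonneg[of 1 1 0] lines_types by simp
  ultimately show ?thesis
    by (metis order_le_less zero_ereal_def)
qed

text \<open>A distribution function that reaches 1 stays there, which contradicts regular variation:
  the tail ratio for \<open>y = 1\<close> has to tend to 1.\<close>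

lemma claim_tail_pos:
  assumes "k \<in> {1..d}" "j \<in> {1..r}"
  shows "0 < 1 - claim_cdf k j x"
proof -
  interpret D: real_distribution "distr M borel (X k j 1)"
    using claim_rv[OF assms, of 1] by simp
  have G: "claim_cdf k j = cdf (distr M borel (X k j 1))"
    using claim_distr[OF assms, of 1] by simp
  have le: "claim_cdf k j y \<le> 1" for y
    unfolding G by (rule D.cdf_bounded_prob)
  have "claim_cdf k j x \<noteq> 1"
  proof
    assume "claim_cdf k j x = 1"
    then have "claim_cdf k j y = 1" if "x \<le> y" for y
      using D.cdf_nondecreasing[OF that] le[of y] by (simp add: G)
    \<comment> \<open>From \<open>x\<close> on, the ratio is 0 / 0, which has the value 0 by
      convention.\<close>
    then have "\<forall>\<^sub>F y in at_top. (1 - claim_cdf k j (1 * y)) / (1 - claim_cdf k j y) = 0"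
      by (intro eventually_at_top_linorderI[of x]) simp
    then have "((\<lambda>y. (1 - claim_cdf k j (1 * y)) / (1 - claim_cdf k j y)) \<longlongrightarrow> 0) at_top"
      by (rule tendsto_eventually)
    moreover have "((\<lambda>y. (1 - claim_cdf k j (1 * y)) / (1 - claim_cdf k j y)) \<longlongrightarrow> 1 powr - \<alpha>) at_top"
      using claim_tail[OF assms] unfolding regularly_varying_tail_def by (meson zero_less_one)
    ultimately have "1 powr - \<alpha> = (0::real)"
      by (intro tendsto_unique[rotated]) auto
    then show False by simp
  qed
  with le[of x] show ?thesis by linarith
qed

section \<open>Closed forms of the three approximations\<close>

text \<open>This prefactor and the next one involve only parameters shared by the models to be
  compared, so both models have the same ones.\<close>

definition tail_constant :: "real \<Rightarrow> real" where
  "tail_constant x = (\<Sum>k = 1..d. \<Sum>j = 1..r. (1 - claim_cdf k j x) * lam k j)"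

definition line_constant :: "nat \<Rightarrow> real" where
  "line_constant k = (\<Sum>j = 1..r. a k j * lam k j)"

lemma tail_constant_pos: "0 < tail_constant x"
  unfolding tail_constant_def
  using lines_types claim_tail_pos intensity by (intro sum_pos mult_pos_pos) auto

lemma line_constant_pos: "k \<in> {1..d} \<Longrightarrow> 0 < line_constant k"
  unfolding line_constant_def
  using lines_types tail_coeff intensity by (intro sum_pos mult_pos_pos) auto

abbreviation I :: "ereal \<Rightarrow> real" where
  "I \<equiv> discount_integral (jump_diffusion_exponent \<mu> \<sigma> \<nu> \<alpha>)"

lemma tail_approx_eq: "tail_approx M d r \<alpha> claim_cdf \<theta> R x t = tail_constant x * I t"
  by (auto simp: tail_approx_def tail_constant_def discounted_renewal_eq sum_distrib_right mult.assoc
      intro!: sum.cong)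

lemma line_weight_eq:
  "k \<in> {1..d} \<Longrightarrow> line_weight M r \<alpha> a \<theta> R k t = line_constant k * I t"
  by (auto simp: line_weight_def line_constant_def discounted_renewal_eq sum_distrib_right mult.assoc
      intro!: sum.cong)

text \<open>All line weights share the positive factor \<open>I t\<close>. It cancels from the outer
  ratio and comes out of the bracket with the power \<open>1 / \<alpha>\<close>.\<close>

lemma SES_approx_eq:
  assumes k: "k \<in> {1..d}" and t: "0 < t"
  shows "SES_approx M d r \<alpha> F a \<theta> R q k t
    = (let A = (\<Sum>i = 1..d. line_constant i) in line_constant k / A
        * (A powr (1 / \<alpha>) - line_constant k powr (1 / \<alpha>) + A powr (1 / \<alpha>) / (\<alpha> - 1)))
      * generalized_inverse F q * I t powr (1 / \<alpha>)"
proof -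
  have I: "0 < I t" by (rule discount_integral_pos[OF t exponent_neg])
  have "(\<Sum>i = 1..d. line_weight M r \<alpha> a \<theta> R i t) = (\<Sum>i = 1..d. line_constant i) * I t"
    by (auto simp: line_weight_eq sum_distrib_right intro!: sum.cong)
  moreover have "0 < (\<Sum>i = 1..d. line_constant i)"
    using lines_types line_constant_pos by (intro sum_pos) auto
  ultimately show ?thesis
    using I line_constant_pos[OF k]
    by (simp add: SES_approx_def Let_def line_weight_eq[OF k] powr_mult field_simps)
qed

text \<open>One factor \<open>I t\<close> in the numerator against the power
  \<open>1 - 1 / \<alpha>\<close> in the denominator leaves the power
  \<open>1 / \<alpha>\<close>.\<close>

lemma MES_approx_eq:
  assumes k: "k \<in> {1..d}" and t: "0 < t"
  shows "MES_approx M d r \<alpha> F a \<theta> R q k t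
    = \<alpha> / (\<alpha> - 1) * (line_constant k / (\<Sum>i = 1..d. line_constant i) powr (1 - 1 / \<alpha>))
      * generalized_inverse F q * I t powr (1 / \<alpha>)"
proof -
  have I: "0 < I t" by (rule discount_integral_pos[OF t exponent_neg])
  let ?A = "\<Sum>i = 1..d. line_constant i"
  have A: "0 < ?A"
    using lines_types line_constant_pos by (intro sum_pos) auto
  have L: "(\<Sum>i = 1..d. line_weight M r \<alpha> a \<theta> R i t) = ?A * I t"
    by (auto simp: line_weight_eq sum_distrib_right intro!: sum.cong)
  have "I t / I t powr (1 - 1 / \<alpha>) = I t powr (1 / \<alpha>)"
    using I by (simp add: powr_diff)
  moreover have "line_constant k * I t / (?A * I t) powr (1 - 1 / \<alpha>)
      = line_constant k / ?A powr (1 - 1 / \<alpha>) * (I t / I t powr (1 - 1 / \<alpha>))"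
    using I A by (simp add: powr_mult)
  ultimately show ?thesis
    unfolding MES_approx_def Let_def line_weight_eq[OF k] L by simp
qed

text \<open>One line constant is at most the sum of all, so the difference of the powers is
  nonnegative; the term divided by \<open>\<alpha> - 1\<close> is strictly positive.\<close>

lemma SES_coefficient_pos:
  assumes k: "k \<in> {1..d}"
  shows "0 < (let A = (\<Sum>i = 1..d. line_constant i) in line_constant k / A
        * (A powr (1 / \<alpha>) - line_constant k powr (1 / \<alpha>) + A powr (1 / \<alpha>) / (\<alpha> - 1)))"
proof -
  have le: "line_constant k \<le> (\<Sum>i = 1..d. line_constant i)"
    using k line_constant_pos by (intro member_le_sum) (auto intro: less_imp_le)
  then have "line_constant k powr (1 / \<alpha>) \<le> (\<Sum>i = 1..d. line_constant i) powr (1 / \<alpha>)"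
    using line_constant_pos[OF k] alpha by (intro powr_mono2) auto
  then show ?thesis
    using le line_constant_pos[OF k] alpha unfolding Let_def
    by (intro mult_pos_pos divide_pos_pos add_nonneg_pos) auto
qed

lemma MES_coefficient_pos:
  assumes k: "k \<in> {1..d}"
  shows "0 < \<alpha> / (\<alpha> - 1) * (line_constant k / (\<Sum>i = 1..d. line_constant i) powr (1 - 1 / \<alpha>))"
proof -
  have "0 < (\<Sum>i = 1..d. line_constant i)"
    using lines_types line_constant_pos by (intro sum_pos) auto
  then show ?thesis
    using line_constant_pos[OF k] alpha by (intro mult_pos_pos divide_pos_pos) auto
qed

end

section \<open>Comparison of two models\<close>

text \<open>By the closed forms, the models, possibly on different probability spaces, differ only
  in the value of \<open>I t\<close>. At a zero quantile both risk measures vanish, hence separate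
  weak and strict versions.\<close>

lemma approximations_mono_exponent:
  assumes m1: "poisson_jump_diffusion_model M\<^sub>1 d r claim_cdf c X\<^sub>1 \<theta>\<^sub>1 R\<^sub>1 \<alpha> F a lam \<mu>\<^sub>1 \<sigma>\<^sub>1 \<nu>\<^sub>1 W\<^sub>1 \<zeta>\<^sub>1 N\<^sub>1"
    and m2: "poisson_jump_diffusion_model M\<^sub>2 d r claim_cdf c X\<^sub>2 \<theta>\<^sub>2 R\<^sub>2 \<alpha> F a lam \<mu>\<^sub>2 \<sigma>\<^sub>2 \<nu>\<^sub>2 W\<^sub>2 \<zeta>\<^sub>2 N\<^sub>2"
    and less: "jump_diffusion_exponent \<mu>\<^sub>1 \<sigma>\<^sub>1 \<nu>\<^sub>1 \<alpha> < jump_diffusion_exponent \<mu>\<^sub>2 \<sigma>\<^sub>2 \<nu>\<^sub>2 \<alpha>"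
    and t: "0 < t"
  shows "tail_approx M\<^sub>1 d r \<alpha> claim_cdf \<theta>\<^sub>1 R\<^sub>1 x t < tail_approx M\<^sub>2 d r \<alpha> claim_cdf \<theta>\<^sub>2 R\<^sub>2 x t"
    and "k \<in> {1..d} \<Longrightarrow> generalized_inverse F q \<ge> 0 \<Longrightarrow>
      SES_approx M\<^sub>1 d r \<alpha> F a \<theta>\<^sub>1 R\<^sub>1 q k t \<le> SES_approx M\<^sub>2 d r \<alpha> F a \<theta>\<^sub>2 R\<^sub>2 q k t \<and>
      MES_approx M\<^sub>1 d r \<alpha> F a \<theta>\<^sub>1 R\<^sub>1 q k t \<le> MES_approx M\<^sub>2 d r \<alpha> F a \<theta>\<^sub>2 R\<^sub>2 q k t"
    and "k \<in> {1..d} \<Longrightarrow> generalized_inverse F q > 0 \<Longrightarrow>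
      SES_approx M\<^sub>1 d r \<alpha> F a \<theta>\<^sub>1 R\<^sub>1 q k t < SES_approx M\<^sub>2 d r \<alpha> F a \<theta>\<^sub>2 R\<^sub>2 q k t \<and>
      MES_approx M\<^sub>1 d r \<alpha> F a \<theta>\<^sub>1 R\<^sub>1 q k t < MES_approx M\<^sub>2 d r \<alpha> F a \<theta>\<^sub>2 R\<^sub>2 q k t"
proof -
  interpret m1: poisson_jump_diffusion_model M\<^sub>1 d r claim_cdf c X\<^sub>1 \<theta>\<^sub>1 R\<^sub>1 \<alpha> F a lam \<mu>\<^sub>1 \<sigma>\<^sub>1 \<nu>\<^sub>1 W\<^sub>1 \<zeta>\<^sub>1 N\<^sub>1
    by (rule m1)
  interpret m2: poisson_jump_diffusion_model M\<^sub>2 d r claim_cdf c X\<^sub>2 \<theta>\<^sub>2 R\<^sub>2 \<alpha> F a lam \<mu>\<^sub>2 \<sigma>\<^sub>2 \<nu>\<^sub>2 W\<^sub>2 \<zeta>\<^sub>2 N\<^sub>2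
    by (rule m2)
  \<comment> \<open>The larger exponent is negative by the second model, which makes both integrals
    finite.\<close>
  have I: "m1.I t < m2.I t"
    by (rule discount_integral_strict_mono[OF t less m2.exponent_neg])
  then have powr: "m1.I t powr (1 / \<alpha>) < m2.I t powr (1 / \<alpha>)"
    using m1.alpha discount_integral_nonneg by (intro powr_less_mono2) auto
  show "tail_approx M\<^sub>1 d r \<alpha> claim_cdf \<theta>\<^sub>1 R\<^sub>1 x t < tail_approx M\<^sub>2 d r \<alpha> claim_cdf \<theta>\<^sub>2 R\<^sub>2 x t"
    using I m2.tail_constant_pos[of x]
    by (simp only: m1.tail_approx_eq m2.tail_approx_eq mult_strict_left_mono)
  show "SES_approx M\<^sub>1 d r \<alpha> F a \<theta>\<^sub>1 R\<^sub>1 q k t \<le> SES_approx M\<^sub>2 d r \<alpha> F a \<theta>\<^sub>2 R\<^sub>2 q k t \<and>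
      MES_approx M\<^sub>1 d r \<alpha> F a \<theta>\<^sub>1 R\<^sub>1 q k t \<le> MES_approx M\<^sub>2 d r \<alpha> F a \<theta>\<^sub>2 R\<^sub>2 q k t"
    if k: "k \<in> {1..d}" and q: "generalized_inverse F q \<ge> 0"
    unfolding m1.SES_approx_eq[OF k t] m2.SES_approx_eq[OF k t] m1.MES_approx_eq[OF k t]
      m2.MES_approx_eq[OF k t]
    using powr q m2.SES_coefficient_pos[OF k] m2.MES_coefficient_pos[OF k]
    by (intro conjI mult_left_mono mult_nonneg_nonneg[OF less_imp_le q]) simp_all
  show "SES_approx M\<^sub>1 d r \<alpha> F a \<theta>\<^sub>1 R\<^sub>1 q k t < SES_approx M\<^sub>2 d r \<alpha> F a \<theta>\<^sub>2 R\<^sub>2 q k t \<and>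
      MES_approx M\<^sub>1 d r \<alpha> F a \<theta>\<^sub>1 R\<^sub>1 q k t < MES_approx M\<^sub>2 d r \<alpha> F a \<theta>\<^sub>2 R\<^sub>2 q k t"
    if k: "k \<in> {1..d}" and q: "generalized_inverse F q > 0"
    unfolding m1.SES_approx_eq[OF k t] m2.SES_approx_eq[OF k t] m1.MES_approx_eq[OF k t]
      m2.MES_approx_eq[OF k t]
    using powr
    by (intro conjI mult_strict_left_mono mult_pos_pos[OF _ q] m2.SES_coefficient_pos[OF k]
        m2.MES_coefficient_pos[OF k])
qed

theorem proposition4p1:
  fixes M\<^sub>1 :: "'a measure" and M\<^sub>2 :: "'b measure"
    and d r :: nat
    and claim_cdf :: "nat \<Rightarrow> nat \<Rightarrow> real \<Rightarrow> real"
    and c :: "nat \<Rightarrow> real"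
    and \<alpha> :: real
    and F :: "real \<Rightarrow> real"
    and a lam :: "nat \<Rightarrow> nat \<Rightarrow> real"
    and \<mu>\<^sub>1 \<sigma>\<^sub>1 \<nu>\<^sub>1 \<mu>\<^sub>2 \<sigma>\<^sub>2 \<nu>\<^sub>2 :: real
  assumes model1:
    "poisson_jump_diffusion_model M\<^sub>1 d r claim_cdf c X\<^sub>1 \<theta>\<^sub>1 R\<^sub>1 \<alpha> F a lam \<mu>\<^sub>1 \<sigma>\<^sub>1 \<nu>\<^sub>1 W\<^sub>1 \<zeta>\<^sub>1 N\<^sub>1"
    and model2:
    "poisson_jump_diffusion_model M\<^sub>2 d r claim_cdf c X\<^sub>2 \<theta>\<^sub>2 R\<^sub>2 \<alpha> F a lam \<mu>\<^sub>2 \<sigma>\<^sub>2 \<nu>\<^sub>2 W\<^sub>2 \<zeta>\<^sub>2 N\<^sub>2"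
  shows
    "(\<mu>\<^sub>1 < \<mu>\<^sub>2 \<and> \<sigma>\<^sub>1 = \<sigma>\<^sub>2 \<and> \<nu>\<^sub>1 = \<nu>\<^sub>2 \<longrightarrow>
      (\<forall>t \<in> time_set M\<^sub>1 d r \<theta>\<^sub>1.
        (\<forall>x. tail_approx M\<^sub>2 d r \<alpha> claim_cdf \<theta>\<^sub>2 R\<^sub>2 x t < tail_approx M\<^sub>1 d r \<alpha> claim_cdf \<theta>\<^sub>1 R\<^sub>1 x t) \<and>
        (\<forall>k \<in> {1..d}. \<forall>q \<in> {0<..<1}.
           (generalized_inverse F q \<ge> 0 \<longrightarrow>
              SES_approx M\<^sub>2 d r \<alpha> F a \<theta>\<^sub>2 R\<^sub>2 q k t \<le> SES_approx M\<^sub>1 d r \<alpha> F a \<theta>\<^sub>1 R\<^sub>1 q k t \<and>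
              MES_approx M\<^sub>2 d r \<alpha> F a \<theta>\<^sub>2 R\<^sub>2 q k t \<le> MES_approx M\<^sub>1 d r \<alpha> F a \<theta>\<^sub>1 R\<^sub>1 q k t) \<and>
           (generalized_inverse F q > 0 \<longrightarrow>
              SES_approx M\<^sub>2 d r \<alpha> F a \<theta>\<^sub>2 R\<^sub>2 q k t < SES_approx M\<^sub>1 d r \<alpha> F a \<theta>\<^sub>1 R\<^sub>1 q k t \<and>
              MES_approx M\<^sub>2 d r \<alpha> F a \<theta>\<^sub>2 R\<^sub>2 q k t < MES_approx M\<^sub>1 d r \<alpha> F a \<theta>\<^sub>1 R\<^sub>1 q k t)))) \<and>
     (\<mu>\<^sub>1 = \<mu>\<^sub>2 \<and> \<sigma>\<^sub>1 < \<sigma>\<^sub>2 \<and> \<nu>\<^sub>1 = \<nu>\<^sub>2 \<longrightarrow>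
      (\<forall>t \<in> time_set M\<^sub>1 d r \<theta>\<^sub>1.
        (\<forall>x. tail_approx M\<^sub>1 d r \<alpha> claim_cdf \<theta>\<^sub>1 R\<^sub>1 x t < tail_approx M\<^sub>2 d r \<alpha> claim_cdf \<theta>\<^sub>2 R\<^sub>2 x t) \<and>
        (\<forall>k \<in> {1..d}. \<forall>q \<in> {0<..<1}.
           (generalized_inverse F q \<ge> 0 \<longrightarrow>
              SES_approx M\<^sub>1 d r \<alpha> F a \<theta>\<^sub>1 R\<^sub>1 q k t \<le> SES_approx M\<^sub>2 d r \<alpha> F a \<theta>\<^sub>2 R\<^sub>2 q k t \<and>
              MES_approx M\<^sub>1 d r \<alpha> F a \<theta>\<^sub>1 R\<^sub>1 q k t \<le> MES_approx M\<^sub>2 d r \<alpha> F a \<theta>\<^sub>2 R\<^sub>2 q k t) \<and>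
           (generalized_inverse F q > 0 \<longrightarrow>
              SES_approx M\<^sub>1 d r \<alpha> F a \<theta>\<^sub>1 R\<^sub>1 q k t < SES_approx M\<^sub>2 d r \<alpha> F a \<theta>\<^sub>2 R\<^sub>2 q k t \<and>
              MES_approx M\<^sub>1 d r \<alpha> F a \<theta>\<^sub>1 R\<^sub>1 q k t < MES_approx M\<^sub>2 d r \<alpha> F a \<theta>\<^sub>2 R\<^sub>2 q k t)))) \<and>
     (\<mu>\<^sub>1 = \<mu>\<^sub>2 \<and> \<sigma>\<^sub>1 = \<sigma>\<^sub>2 \<and> \<nu>\<^sub>1 < \<nu>\<^sub>2 \<longrightarrow>
      (\<forall>t \<in> time_set M\<^sub>1 d r \<theta>\<^sub>1.
        (\<forall>x. tail_approx M\<^sub>1 d r \<alpha> claim_cdf \<theta>\<^sub>1 R\<^sub>1 x t < tail_approx M\<^sub>2 d r \<alpha> claim_cdf \<theta>\<^sub>2 R\<^sub>2 x t) \<and>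
        (\<forall>k \<in> {1..d}. \<forall>q \<in> {0<..<1}.
           (generalized_inverse F q \<ge> 0 \<longrightarrow>
              SES_approx M\<^sub>1 d r \<alpha> F a \<theta>\<^sub>1 R\<^sub>1 q k t \<le> SES_approx M\<^sub>2 d r \<alpha> F a \<theta>\<^sub>2 R\<^sub>2 q k t \<and>
              MES_approx M\<^sub>1 d r \<alpha> F a \<theta>\<^sub>1 R\<^sub>1 q k t \<le> MES_approx M\<^sub>2 d r \<alpha> F a \<theta>\<^sub>2 R\<^sub>2 q k t) \<and>
           (generalized_inverse F q > 0 \<longrightarrow>
              SES_approx M\<^sub>1 d r \<alpha> F a \<theta>\<^sub>1 R\<^sub>1 q k t < SES_approx M\<^sub>2 d r \<alpha> F a \<theta>\<^sub>2 R\<^sub>2 q k t \<and>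
              MES_approx M\<^sub>1 d r \<alpha> F a \<theta>\<^sub>1 R\<^sub>1 q k t < MES_approx M\<^sub>2 d r \<alpha> F a \<theta>\<^sub>2 R\<^sub>2 q k t))))"
proof -
  interpret m1: poisson_jump_diffusion_model M\<^sub>1 d r claim_cdf c X\<^sub>1 \<theta>\<^sub>1 R\<^sub>1 \<alpha> F a lam \<mu>\<^sub>1 \<sigma>\<^sub>1 \<nu>\<^sub>1 W\<^sub>1 \<zeta>\<^sub>1 N\<^sub>1
    by (rule model1)
  \<comment> \<open>The exponent decreases in the drift, so here the second model has the smaller
    exponent.\<close>
  have drift: "jump_diffusion_exponent \<mu>\<^sub>2 \<sigma>\<^sub>2 \<nu>\<^sub>2 \<alpha> < jump_diffusion_exponent \<mu>\<^sub>1 \<sigma>\<^sub>1 \<nu>\<^sub>1 \<alpha>"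
    if "\<mu>\<^sub>1 < \<mu>\<^sub>2 \<and> \<sigma>\<^sub>1 = \<sigma>\<^sub>2 \<and> \<nu>\<^sub>1 = \<nu>\<^sub>2"
    using that m1.alpha by (simp add: jump_diffusion_exponent_def)
  \<comment> \<open>Squaring preserves the strict order because \<open>\<sigma>\<^sub>1\<close> is
    nonnegative.\<close>
  have volatility: "jump_diffusion_exponent \<mu>\<^sub>1 \<sigma>\<^sub>1 \<nu>\<^sub>1 \<alpha> < jump_diffusion_exponent \<mu>\<^sub>2 \<sigma>\<^sub>2 \<nu>\<^sub>2 \<alpha>"
    if "\<mu>\<^sub>1 = \<mu>\<^sub>2 \<and> \<sigma>\<^sub>1 < \<sigma>\<^sub>2 \<and> \<nu>\<^sub>1 = \<nu>\<^sub>2"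
    using that m1.alpha m1.volatility
    by (simp add: jump_diffusion_exponent_def power_mult_distrib power_strict_mono)
  \<comment> \<open>The coefficient \<open>exp (\<alpha>\<^sup>2 / 2) - 1\<close> of the jump
    intensity is positive.\<close>
  have jumps: "jump_diffusion_exponent \<mu>\<^sub>1 \<sigma>\<^sub>1 \<nu>\<^sub>1 \<alpha> < jump_diffusion_exponent \<mu>\<^sub>2 \<sigma>\<^sub>2 \<nu>\<^sub>2 \<alpha>"
    if "\<mu>\<^sub>1 = \<mu>\<^sub>2 \<and> \<sigma>\<^sub>1 = \<sigma>\<^sub>2 \<and> \<nu>\<^sub>1 < \<nu>\<^sub>2"
    using that m1.alpha by (simp add: jump_diffusion_exponent_def)
  \<comment> \<open>The first block takes the models in reversed order. Each block yields the tail,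
    weak and strict comparisons; the last two are conjunctions that the final step splits into their
    SES and MES parts.\<close>
  note mono = approximations_mono_exponent[OF model2 model1 drift m1.time_set_pos]
    approximations_mono_exponent[OF model1 model2 volatility m1.time_set_pos]
    approximations_mono_exponent[OF model1 model2 jumps m1.time_set_pos]
  show ?thesis
    by (intro conjI impI ballI allI;
        (rule mono mono(2,3,5,6,8,9)[THEN conjunct1] mono(2,3,5,6,8,9)[THEN conjunct2]; assumption))
qed

end
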